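(* Let $p\in[-1,1]$, $p\neq0$. For any point $x^{(0)}=(x^{(0)}_1,x^{(0)}_2,x^{(0)}_3,1-x^{(0)}_1-x^{(0)}_2-x^{(0)}_3,0)\in S^4$ whose first four coordinates are all non-zero, we have: a) If $x^{(0)}\in\overline{MN}^{\pi}$, then the trajectory $x^{(n)}=W^n(x^{(0)})$ converges to the 5-periodic orbit of $W$ $$(\tfrac13,\tfrac13,\tfrac13,0,0)\to(0,\tfrac13,\tfrac13,\tfrac13,0)\to(0,0,\tfrac13,\tfrac13,\tfrac13)\to(\tfrac13,0,0,\tfrac13,\tfrac13)\to(\tfrac13,\tfrac13,0,0,\tfrac13)\to(\tfrac13,\tfrac13,\tfrac13,0,0).$$ b) If $x^{(0)}\notin\overline{MN}^{\pi}$, then the trajectory $x^{(n)}=W^n(x^{(0)})$ does not converge and its set of limit points is infinite and lies on the boundary $\partial S^4$.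
   Context: $S^4=\{x=(x_1,\dots,x_5)\in\mathbb{R}^5: x_i\ge 0,\ \sum_{i=1}^5 x_i=1\}$ and $\partial S^4=\{x\in S^4: x_1x_2x_3x_4x_5=0\}$. For $p\in[-1,1]$, the operator $W:S^4\to S^4$, $W(x)=x'$, is defined by $$\begin{aligned} x'_1&=x_5[1+p(x_1-x_2+x_3-x_4)],\\ x'_2&=x_1[1+p(x_2-x_3+x_4-x_5)],\\ x'_3&=x_2[1-p(x_1-x_3+x_4-x_5)],\\ x'_4&=x_3[1+p(x_1-x_2+x_4-x_5)],\\ x'_5&=x_4[1-p(x_1-x_2+x_3-x_5)]. \end{aligned}$$ $W^n$ is the $n$-th iterate of $W$. $T_\pi:S^4\to S^4$ is $T_\pi(x_1,x_2,x_3,x_4,x_5)=(x_5,x_1,x_2,x_3,x_4)$. $\overline{MN}=\{(\frac{1-u}{3},\frac13,\frac13,\frac u3,0): u\in[0,1]\}\subset S^4$. For $U\subset S^4$, $T_\pi U=\{T_\pi u:u\in U\}$ and $U^\pi=U\cup T_\pi U\cup T_\pi^2U\cup T_\pi^3U\cup T_\pi^4U$; thus $\overline{MN}^\pi$ is this set for $U=\overline{MN}$. A trajectory $W^n(x)$ converges to a periodic orbit $\mathcal{O}$ if there is a point $y\in\mathcal{O}$ with $\|W^n(x)-W^n(y)\|\to0$ as $n\to\infty$. Limit points are subsequential limits. *)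

theory Defs
  imports "HOL-Analysis.Analysis"
begin

(* Points of R^5 have type real^5 and coordinates x $ 1, ..., x $ 5.  In the five-element
   index type 5 the numerals 5 and 0 denote the same index; the lemmas below extend the
   library's facts for the index types 1 to 4. *)

lemma exhaust_5:
  fixes x :: 5
  shows "x = 1 \<or> x = 2 \<or> x = 3 \<or> x = 4 \<or> x = 5"
proof (induct x)
  case (of_int z)
  then have "z = 0 \<or> z = 1 \<or> z = 2 \<or> z = 3 \<or> z = 4" by fastforce
  then show ?case by auto
qed

lemma forall_5: "(\<forall>i::5. P i) \<longleftrightarrow> P 1 \<and> P 2 \<and> P 3 \<and> P 4 \<and> P 5"
  by (metis exhaust_5)

lemma UNIV_5: "UNIV = {1, 2, 3, 4, 5::5}"
  using exhaust_5 by auto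

lemma sum_5: "sum f (UNIV::5 set) = f 1 + f 2 + f 3 + f 4 + f 5"
  unfolding UNIV_5 by (simp add: ac_simps)

lemma vector_5 [simp]:
  "(vector [a,b,c,d,e] :: ('a::zero)^5) $ 1 = a"
  "(vector [a,b,c,d,e] :: ('a::zero)^5) $ 2 = b"
  "(vector [a,b,c,d,e] :: ('a::zero)^5) $ 3 = c"
  "(vector [a,b,c,d,e] :: ('a::zero)^5) $ 4 = d"
  "(vector [a,b,c,d,e] :: ('a::zero)^5) $ 5 = e"
  unfolding vector_def by simp_all

definition S4 :: "(real^5) set" where
  "S4 = {x. (\<forall>i. 0 \<le> x $ i) \<and> (\<Sum>i\<in>UNIV. x $ i) = 1}"

definition boundary_S4 :: "(real^5) set" where
  "boundary_S4 = {x \<in> S4. x $ 1 * x $ 2 * x $ 3 * x $ 4 * x $ 5 = 0}"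

(* Total on real^5; lemma W_in_S4 shows that it restricts to a self-map of S4. *)
definition W :: "real \<Rightarrow> real^5 \<Rightarrow> real^5" where
  "W p x = vector
     [x $ 5 * (1 + p * (x $ 1 - x $ 2 + x $ 3 - x $ 4)),
      x $ 1 * (1 + p * (x $ 2 - x $ 3 + x $ 4 - x $ 5)),
      x $ 2 * (1 - p * (x $ 1 - x $ 3 + x $ 4 - x $ 5)),
      x $ 3 * (1 + p * (x $ 1 - x $ 2 + x $ 4 - x $ 5)),
      x $ 4 * (1 - p * (x $ 1 - x $ 2 + x $ 3 - x $ 5))]"

lemma W_in_S4:
  assumes p: "-1 \<le> p" "p \<le> 1" and x: "x \<in> S4"
  shows "W p x \<in> S4"
proof -
  have nn: "0 \<le> x $ 1" "0 \<le> x $ 2" "0 \<le> x $ 3" "0 \<le> x $ 4" "0 \<le> x $ 5"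
    and s: "x $ 1 + x $ 2 + x $ 3 + x $ 4 + x $ 5 = 1"
    using x by (auto simp: S4_def sum_5)
  have bound: "\<bar>p * t\<bar> \<le> 1" if "\<bar>t\<bar> \<le> 1" for t
  proof -
    have "\<bar>p\<bar> * \<bar>t\<bar> \<le> 1 * 1" using p that by (intro mult_mono) auto
    then show ?thesis by (simp add: abs_mult)
  qed
  have b1: "\<bar>p * (x $ 1 - x $ 2 + x $ 3 - x $ 4)\<bar> \<le> 1"
    by (rule bound) (use nn s in linarith)
  have b2: "\<bar>p * (x $ 2 - x $ 3 + x $ 4 - x $ 5)\<bar> \<le> 1"
    by (rule bound) (use nn s in linarith)
  have b3: "\<bar>p * (x $ 1 - x $ 3 + x $ 4 - x $ 5)\<bar> \<le> 1"
    by (rule bound) (use nn s in linarith)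
  have b4: "\<bar>p * (x $ 1 - x $ 2 + x $ 4 - x $ 5)\<bar> \<le> 1"
    by (rule bound) (use nn s in linarith)
  have b5: "\<bar>p * (x $ 1 - x $ 2 + x $ 3 - x $ 5)\<bar> \<le> 1"
    by (rule bound) (use nn s in linarith)
  have "\<forall>i. 0 \<le> W p x $ i"
    unfolding forall_5 W_def vector_5
    using b1 b2 b3 b4 b5 by (intro conjI mult_nonneg_nonneg nn) linarith+
  moreover have "(\<Sum>i\<in>UNIV. W p x $ i) = x $ 1 + x $ 2 + x $ 3 + x $ 4 + x $ 5"
    by (simp add: sum_5 W_def algebra_simps)
  ultimately show ?thesis using s by (simp add: S4_def)
qed

definition T_pi :: "real^5 \<Rightarrow> real^5" where
  "T_pi x = vector [x $ 5, x $ 1, x $ 2, x $ 3, x $ 4]"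

definition pi_orbit :: "(real^5) set \<Rightarrow> (real^5) set" where
  "pi_orbit U = U \<union> T_pi ` U \<union> (T_pi ^^ 2) ` U \<union> (T_pi ^^ 3) ` U \<union> (T_pi ^^ 4) ` U"

definition seg_MN :: "(real^5) set" where
  "seg_MN = {vector [(1 - u) / 3, 1/3, 1/3, u / 3, 0] | u. u \<in> {0..1}}"

(* The list records the orbit in the order in which f runs through it; distinctness makes k
   the least period. *)
definition periodic_orbit :: "('a \<Rightarrow> 'a) \<Rightarrow> nat \<Rightarrow> 'a list \<Rightarrow> bool" where
  "periodic_orbit f k ys \<longleftrightarrow>
     0 < k \<and> length ys = k \<and> distinct ys \<and> (\<forall>i<k. f (ys ! i) = ys ! ((i + 1) mod k))"

definition trajectory_converges_to_orbit ::
    "('a::real_normed_vector \<Rightarrow> 'a) \<Rightarrow> 'a \<Rightarrow> 'a set \<Rightarrow> bool" where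
  "trajectory_converges_to_orbit f x Orb \<longleftrightarrow>
     (\<exists>y\<in>Orb. (\<lambda>n. norm ((f ^^ n) x - (f ^^ n) y)) \<longlonglongrightarrow> 0)"

definition limit_points :: "(nat \<Rightarrow> 'a::topological_space) \<Rightarrow> 'a set" where
  "limit_points X = {l. \<exists>r::nat \<Rightarrow> nat. strict_mono r \<and> (X \<circ> r) \<longlonglongrightarrow> l}"

definition orbit5 :: "(real^5) list" where
  "orbit5 =
     [vector [1/3, 1/3, 1/3, 0, 0],
      vector [0, 1/3, 1/3, 1/3, 0],
      vector [0, 0, 1/3, 1/3, 1/3],
      vector [1/3, 0, 0, 1/3, 1/3],
      vector [1/3, 1/3, 0, 0, 1/3]]"

end

theory Submission
  imports Defs
begin

text \<open>Two observations reduce the statement to a three-species game.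

  The operator is a Lotka--Volterra map \<open>V\<close> (below: \<open>lotka\<close>) followed by the cyclic shift of
  the coordinates, and the two commute, so \<open>W\<^sup>n = T\<^sup>n V\<^sup>n\<close>.  The shift has order five and is an
  isometry, which makes it harmless: distances do not see it, and an infinite set of limit points
  of \<open>V\<^sup>n x\<close> remains infinite when each term is moved by one of five injective maps
  (\<open>infinite_limit_points_moving_frame\<close>).

  The map \<open>V\<close> keeps the face \<open>x\<^sub>5 = 0\<close>.  There species 1 and 4 play identically against 2 and
  against 3, and what they take from each other cancels in \<open>x\<^sub>1 + x\<^sub>4\<close>.  Hence
  \<open>(x\<^sub>1 + x\<^sub>4, x\<^sub>2, x\<^sub>3)\<close> evolves by itself, as the rock-paper-scissors map \<open>rps\<close> on the triangle,
  and the segment \<open>MN\<close> is exactly the fibre over the centre of the triangle.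

  Over the centre, the motion along the segment is logistic and runs from any interior point to
  an end point of the segment; both end points lie on the 5-periodic orbit.

  Off the centre, the inequality of arithmetic and geometric means makes the product of the three
  coordinates a strict Lyapunov function, so that all limit points lie on the sides of the
  triangle.  If there were only finitely many, none could be in the relative interior of a side,
  as one of its two species gains there at every step; so all limit points would be vertices.
  Steps are too short for the trajectory to keep jumping between neighbourhoods of different
  vertices, so it would stay near one of them, where one of the two rare species grows
  geometrically: a contradiction.  So there are infinitely many limit points
  (\<open>infinite_limit_points_rps\<close>), and they lift back to the simplex by compactness.

  That the limit points of \<open>W\<^sup>n x\<close> lie on the boundary is automatic, because \<open>W\<close> maps the
  boundary into itself and the boundary is closed.\<close>

section \<open>Limit points of sequences\<close>

lemma limit_points_continuous_image:
  assumes "l \<in> limit_points X" and "continuous_on UNIV f"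
  shows "f l \<in> limit_points (\<lambda>n. f (X n))"
proof -
  obtain r :: "nat \<Rightarrow> nat" where r: "strict_mono r" "(X \<circ> r) \<longlonglongrightarrow> l"
    using assms(1) by (auto simp: limit_points_def)
  have "(\<lambda>n. f ((X \<circ> r) n)) \<longlonglongrightarrow> f l"
    using continuous_on_tendsto_compose[OF assms(2) r(2)] by auto
  then show ?thesis
    using r(1) by (auto simp: limit_points_def comp_def)
qed

lemma limit_points_orbit_invariant:
  assumes "l \<in> limit_points (\<lambda>n. (f ^^ n) z)" and "continuous_on UNIV f"
  shows "f l \<in> limit_points (\<lambda>n. (f ^^ n) z)"
proof -
  have "f l \<in> limit_points (\<lambda>n. (f ^^ Suc n) z)"
    using limit_points_continuous_image[OF assms] by simp
  then obtain r :: "nat \<Rightarrow> nat"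
    where r: "strict_mono r" "((\<lambda>n. (f ^^ Suc n) z) \<circ> r) \<longlonglongrightarrow> f l"
    by (auto simp: limit_points_def simp del: funpow.simps)
  have "strict_mono (Suc \<circ> r)"
    using r(1) by (auto simp: strict_mono_def)
  moreover have "((\<lambda>n. (f ^^ n) z) \<circ> (Suc \<circ> r)) \<longlonglongrightarrow> f l"
    using r(2) by (simp add: comp_def del: funpow.simps)
  ultimately show ?thesis
    unfolding limit_points_def by blast
qed

lemma limit_points_subset_closed:
  assumes "closed S" and "\<And>n. X n \<in> S"
  shows "limit_points X \<subseteq> S"
proof
  fix l assume "l \<in> limit_points X"
  then obtain r :: "nat \<Rightarrow> nat" where "(X \<circ> r) \<longlonglongrightarrow> l"
    unfolding limit_points_def by blast
  then show "l \<in> S"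
    using closed_sequentially[OF assms(1), of "X \<circ> r" l] assms(2) by simp
qed

lemma limit_points_convergent:
  fixes X :: "nat \<Rightarrow> 'a::t2_space"
  assumes "X \<longlonglongrightarrow> L" and "l \<in> limit_points X"
  shows "l = L"
proof -
  obtain r :: "nat \<Rightarrow> nat" where "strict_mono r" "(X \<circ> r) \<longlonglongrightarrow> l"
    using assms(2) unfolding limit_points_def by blast
  then show ?thesis
    using LIMSEQ_subseq_LIMSEQ[OF assms(1)] LIMSEQ_unique by blast
qed

lemma limit_point_if_frequently:
  fixes X :: "nat \<Rightarrow> 'a::metric_space"
  assumes "compact K" and "\<exists>\<^sub>F n in sequentially. X n \<in> K"
  shows "\<exists>l\<in>K. l \<in> limit_points X"
proof -
  have "infinite {n. X n \<in> K}"
    using assms(2) by (simp add: frequently_cofinite flip: cofinite_eq_sequentially)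
  then obtain q :: "nat \<Rightarrow> nat" where q: "strict_mono q" "\<And>n. X (q n) \<in> K"
    using infinite_enumerate by blast
  obtain l r where "l \<in> K" "strict_mono r" "((X \<circ> q) \<circ> r) \<longlonglongrightarrow> l"
    using assms(1) q(2) unfolding compact_def by (metis comp_apply)
  then show ?thesis
    using q(1) strict_mono_o[of q r] by (auto simp: limit_points_def comp_assoc)
qed

lemma limit_points_image_compact:
  fixes X :: "nat \<Rightarrow> 'a::metric_space" and f :: "'a \<Rightarrow> 'b::t2_space"
  assumes "compact K" and "\<And>n. X n \<in> K" and "continuous_on UNIV f"
  shows "limit_points (\<lambda>n. f (X n)) \<subseteq> f ` limit_points X"
proof
  fix l assume "l \<in> limit_points (\<lambda>n. f (X n))"
  then obtain r :: "nat \<Rightarrow> nat" where r: "strict_mono r" "(\<lambda>n. f (X (r n))) \<longlonglongrightarrow> l"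
    by (auto simp: limit_points_def comp_def)
  have "\<forall>n. (X \<circ> r) n \<in> K"
    using assms(2) by simp
  then obtain y q where q: "strict_mono q" "((X \<circ> r) \<circ> q) \<longlonglongrightarrow> y"
    using assms(1) unfolding compact_def by blast
  have "(\<lambda>n. f (X (r (q n)))) \<longlonglongrightarrow> f y"
    using continuous_on_tendsto_compose[OF assms(3) q(2)] by (simp add: comp_def)
  moreover have "(\<lambda>n. f (X (r (q n)))) \<longlonglongrightarrow> l"
    using LIMSEQ_subseq_LIMSEQ[OF r(2) q(1)] by (simp add: comp_def)
  ultimately have "l = f y"
    using LIMSEQ_unique by blast
  moreover have "y \<in> limit_points X"
    using q strict_mono_o[OF r(1) q(1)] by (auto simp: limit_points_def comp_assoc)
  ultimately show "l \<in> f ` limit_points X" by blast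
qed

text \<open>Along a subsequence of \<open>X\<close> converging to \<open>l\<close>, some residue \<open>i\<close> of the index modulo \<open>k\<close>
  occurs infinitely often, so \<open>h i l\<close> is a limit point of \<open>Y\<close>.  Thus finitely many injective
  preimages of the limit points of \<open>Y\<close> cover those of \<open>X\<close>.\<close>

lemma infinite_limit_points_moving_frame:
  assumes "0 < k" and "\<And>i. inj (h i)" and "\<And>i. continuous_on UNIV (h i)"
    and Y: "\<And>n. Y n = h (n mod k) (X n)"
    and "infinite (limit_points X)"
  shows "infinite (limit_points Y)"
proof
  assume fin: "finite (limit_points Y)"
  have "limit_points X \<subseteq> (\<Union>i<k. h i -` limit_points Y)"
  proof
    fix l assume "l \<in> limit_points X"
    then obtain r :: "nat \<Rightarrow> nat" where r: "strict_mono r" "(X \<circ> r) \<longlonglongrightarrow> l"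
      unfolding limit_points_def by blast
    have "(\<lambda>n. r n mod k) ` UNIV \<subseteq> {..<k}"
      using assms(1) by (simp add: image_subset_iff)
    then have "finite ((\<lambda>n. r n mod k) ` UNIV)"
      using finite_subset by blast
    then obtain m where m: "infinite {n \<in> UNIV. r n mod k = r m mod k}"
      using pigeonhole_infinite[of "UNIV :: nat set" "\<lambda>n. r n mod k"] by auto
    then obtain q :: "nat \<Rightarrow> nat" where q: "strict_mono q" "\<And>n. r (q n) mod k = r m mod k"
      using infinite_enumerate[of "{n \<in> UNIV. r n mod k = r m mod k}"] by auto
    have "((X \<circ> r) \<circ> q) \<longlonglongrightarrow> l"
      using LIMSEQ_subseq_LIMSEQ[OF r(2) q(1)] .
    then have "(\<lambda>n. h (r m mod k) (X (r (q n)))) \<longlonglongrightarrow> h (r m mod k) l"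
      using continuous_on_tendsto_compose[OF assms(3)] by (auto simp: comp_def)
    then have "(Y \<circ> (r \<circ> q)) \<longlonglongrightarrow> h (r m mod k) l"
      using q(2) by (simp add: Y comp_def)
    then have "h (r m mod k) l \<in> limit_points Y"
      using strict_mono_o[OF r(1) q(1)] by (auto simp: limit_points_def)
    then show "l \<in> (\<Union>i<k. h i -` limit_points Y)"
      using assms(1) by (auto intro!: bexI[of _ "r m mod k"])
  qed
  moreover have "finite (\<Union>i<k. h i -` limit_points Y)"
    using fin assms(2) by (auto intro: finite_vimageI)
  ultimately show False
    using assms(5) finite_subset by blast
qed

section \<open>The rock-paper-scissors map on the triangle\<close>

definition unit_simplex :: "(real^'n::finite) set" where
  "unit_simplex = {x. (\<forall>i. 0 \<le> x $ i) \<and> (\<Sum>i\<in>UNIV. x $ i) = 1}"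

lemma compact_unit_simplex: "compact (unit_simplex :: (real^'n::finite) set)"
proof -
  have "norm x \<le> 1" if "x \<in> unit_simplex" for x :: "real^'n"
    using norm_le_l1_cart[of x] that by (simp add: unit_simplex_def)
  then have "bounded (unit_simplex :: (real^'n) set)"
    by (auto simp: bounded_iff)
  moreover have "closed (unit_simplex :: (real^'n) set)"
    unfolding unit_simplex_def
    by (intro closed_Collect_conj closed_Collect_all closed_Collect_le closed_Collect_eq
        continuous_intros)
  ultimately show ?thesis by (simp add: compact_eq_bounded_closed)
qed

text \<open>Indices in the type \<open>3\<close> are added modulo three, so that \<open>i\<close>, \<open>i + 1\<close>, \<open>i + 2\<close> are all
  of them.  Writing coordinates this way keeps the cyclic symmetry visible and saves a separate
  argument for each side of the triangle.\<close>

lemma add_index_3: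
  fixes i :: 3
  shows "i + 1 + 1 = i + 2" "i + 1 + 2 = i" "i + 2 + 1 = i" "i + 2 + 2 = i + 1"
  using exhaust_3[of i] by auto

text \<open>The simplifier adds numerals of type \<open>3\<close> without reducing them; the sums \<open>i + j\<close> with
  \<open>i \<le> 3\<close> and \<open>j \<le> 2\<close> make no other cases necessary.\<close>

lemma reduce_index_3: "(4::3) = 1" "(5::3) = 2"
  by simp_all

lemma forall_index_3: "(\<forall>j::3. P j) \<longleftrightarrow> P i \<and> P (i + 1) \<and> P (i + 2)"
  using exhaust_3[of i] by (elim disjE)
    (simp_all add: forall_3 reduce_index_3 conj_commute conj_left_commute)

lemma sum_index_3: "(\<Sum>j\<in>UNIV. f (j::3)) = f i + f (i + 1) + f (i + 2)"
  using exhaust_3[of i] by (elim disjE) (simp_all add: sum_3 reduce_index_3 ac_simps)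

lemma prod_index_3: "(\<Prod>j\<in>UNIV. f (j::3)) = f i * f (i + 1) * f (i + 2)"
proof -
  have "(\<Prod>j\<in>UNIV. f j) = f 1 * f 2 * f 3"
    unfolding UNIV_3 by (simp add: mult.assoc)
  also have "f 1 * f 2 * f 3 = f i * f (i + 1) * f (i + 2)"
    using exhaust_3[of i] by (elim disjE)
      (simp_all add: reduce_index_3 mult.assoc mult.commute mult.left_commute)
  finally show ?thesis .
qed

text \<open>Each species gains from the next one in the cycle and loses to the one after that, with
  strength \<open>p\<close>; a negative \<open>p\<close> reverses the cycle.\<close>

definition rps :: "real \<Rightarrow> real^3 \<Rightarrow> real^3" where
  "rps p z = (\<chi> i. z $ i * (1 + p * (z $ (i + 1) - z $ (i + 2))))"

lemma rps_nth: "rps p z $ i = z $ i * (1 + p * (z $ (i + 1) - z $ (i + 2)))"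
  by (simp add: rps_def)

lemma continuous_on_rps: "continuous_on UNIV (rps p)"
  unfolding rps_def by (intro continuous_intros)

lemma simplex_3D:
  fixes z :: "real^3"
  assumes "z \<in> unit_simplex"
  shows "0 \<le> z $ i" "z $ i + z $ (i + 1) + z $ (i + 2) = 1"
  using assms sum_index_3[of "\<lambda>j. z $ j" i] by (auto simp: unit_simplex_def)

lemma rps_factor_bound:
  fixes z :: "real^3"
  assumes "\<bar>p\<bar> \<le> 1" and "z \<in> unit_simplex"
  shows "\<bar>p * (z $ (i + 1) - z $ (i + 2))\<bar> \<le> 1 - z $ i"
proof -
  have "\<bar>z $ (i + 1) - z $ (i + 2)\<bar> \<le> 1 - z $ i"
    using simplex_3D[OF assms(2)] by (smt (verit))
  moreover have "\<bar>p\<bar> * \<bar>z $ (i + 1) - z $ (i + 2)\<bar> \<le> 1 * \<bar>z $ (i + 1) - z $ (i + 2)\<bar>"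
    using assms(1) by (intro mult_right_mono) auto
  ultimately show ?thesis by (simp add: abs_mult)
qed

lemma rps_in_simplex:
  assumes "\<bar>p\<bar> \<le> 1" and "z \<in> unit_simplex"
  shows "rps p z \<in> unit_simplex"
proof -
  have "0 \<le> rps p z $ i" for i
    using rps_factor_bound[OF assms, of i] simplex_3D[OF assms(2), of i]
    by (auto simp: rps_nth intro!: mult_nonneg_nonneg)
  moreover have "(\<Sum>i\<in>UNIV. rps p z $ i) = z $ 1 + z $ 2 + z $ 3"
    by (simp add: sum_3 rps_nth reduce_index_3 algebra_simps)
  ultimately show ?thesis
    using assms(2) by (simp add: unit_simplex_def sum_3)
qed

lemma rps_pos:
  assumes "\<bar>p\<bar> \<le> 1" and "z \<in> unit_simplex" and "0 < z $ i"
  shows "0 < rps p z $ i"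
  using rps_factor_bound[OF assms(1,2), of i] assms(3)
  by (auto simp: rps_nth intro!: mult_pos_pos)

text \<open>The difference of the two sides is a combination, with nonnegative coefficients, of the
  squares of \<open>u - v\<close>, \<open>v - w\<close> and \<open>w - u\<close>, and this settles the case of equality as well.\<close>

lemma amgm_3:
  fixes u v w :: real
  assumes "0 \<le> u" "0 \<le> v" "0 \<le> w"
  shows "27 * (u * v * w) \<le> (u + v + w) ^ 3"
    and "0 < u + v + w \<Longrightarrow> 27 * (u * v * w) = (u + v + w) ^ 3 \<Longrightarrow> u = v \<and> v = w"
proof -
  define A where "A = (u - v)\<^sup>2 + (v - w)\<^sup>2 + (w - u)\<^sup>2"
  define B where "B = 3 * (u * (v - w)\<^sup>2 + v * (w - u)\<^sup>2 + w * (u - v)\<^sup>2)"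
  define C where "C = (u + v + w) / 2 * A"
  have id: "(u + v + w) ^ 3 - 27 * (u * v * w) = C + B"
    by (simp add: A_def B_def C_def power2_eq_square power3_eq_cube field_simps)
  have nn: "0 \<le> A" "0 \<le> B" "0 \<le> C"
    using assms by (simp_all add: A_def B_def C_def)
  show "27 * (u * v * w) \<le> (u + v + w) ^ 3"
    using id nn by linarith
  assume pos: "0 < u + v + w" and eq: "27 * (u * v * w) = (u + v + w) ^ 3"
  have "C = 0"
    using id nn eq by linarith
  then have "A = 0"
    using pos by (simp add: C_def)
  then have "(u - v)\<^sup>2 = 0" "(v - w)\<^sup>2 = 0"
    using zero_le_power2[of "u - v"] zero_le_power2[of "v - w"] zero_le_power2[of "w - u"]
    unfolding A_def by linarith+
  then show "u = v \<and> v = w" by simp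
qed

definition coord_prod :: "real^3 \<Rightarrow> real" where
  "coord_prod z = (\<Prod>i\<in>UNIV. z $ i)"

lemma continuous_on_coord_prod: "continuous_on UNIV coord_prod"
  unfolding coord_prod_def by (intro continuous_intros)

text \<open>The three growth factors add up to three, because each coordinate enters one of them with
  coefficient \<open>p\<close> and another one with \<open>- p\<close>.  So their product is at most one, with equality only if all payoffs vanish, and
  this happens only at the centre, where the product of the coordinates is \<open>1/27\<close>.\<close>

lemma coord_prod_rps:
  assumes "\<bar>p\<bar> \<le> 1" and "p \<noteq> 0" and "z \<in> unit_simplex"
  shows "coord_prod (rps p z) \<le> coord_prod z"
    and "coord_prod (rps p z) = coord_prod z \<Longrightarrow> coord_prod z = 0 \<or> coord_prod z = 1 / 27"
proof -
  define g where "g i = 1 + p * (z $ (i + 1) - z $ (i + 2))" for i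
  note zi = simplex_3D[OF assms(3)]
  have g: "0 \<le> g i" for i
    using rps_factor_bound[OF assms(1,3), of i] zi(1)[of i] by (simp add: g_def)
  have gsum: "g 1 + g 2 + g 3 = 3"
    by (simp add: g_def reduce_index_3 algebra_simps)
  have Q: "coord_prod (rps p z) = coord_prod z * (g 1 * g 2 * g 3)"
    using prod_index_3[of g 1]
    by (simp add: coord_prod_def rps_nth g_def prod.distrib)
  have Q0: "0 \<le> coord_prod z"
    using zi by (simp add: coord_prod_def prod_nonneg)
  have le1: "g 1 * g 2 * g 3 \<le> 1"
    using amgm_3(1)[of "g 1" "g 2" "g 3"] g gsum by simp
  show "coord_prod (rps p z) \<le> coord_prod z"
    using Q mult_left_mono[OF le1 Q0] by simp
  assume eq: "coord_prod (rps p z) = coord_prod z"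
  show "coord_prod z = 0 \<or> coord_prod z = 1 / 27"
  proof (cases "coord_prod z = 0")
    case False
    then have "g 1 * g 2 * g 3 = 1"
      using eq Q by simp
    then have "g 1 = g 2 \<and> g 2 = g 3"
      using amgm_3(2)[of "g 1" "g 2" "g 3"] g gsum by simp
    then have "g 1 = 1" "g 2 = 1" "g 3 = 1"
      using gsum by auto
    then have "z $ 1 = z $ 2" "z $ 2 = z $ 3"
      using assms(2) by (auto simp: g_def reduce_index_3)
    then have "z $ 1 = 1/3" "z $ 2 = 1/3" "z $ 3 = 1/3"
      using zi(2)[of 1] by auto
    moreover have "coord_prod z = z $ 1 * z $ 2 * z $ 3"
      using prod_index_3[of "\<lambda>i. z $ i" 1] by (simp add: coord_prod_def)
    ultimately have "coord_prod z = 1/3 * (1/3) * (1/3)"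
      by (simp only:)
    then show ?thesis by simp
  qed simp
qed

lemma coord_prod_max:
  assumes "z \<in> unit_simplex" and "z $ 1 \<noteq> z $ 2 \<or> z $ 2 \<noteq> z $ 3"
  shows "coord_prod z < 1 / 27"
proof -
  have P: "coord_prod z = z $ 1 * z $ 2 * z $ 3"
    using prod_index_3[of "\<lambda>i. z $ i" 1] by (simp add: coord_prod_def)
  have S: "z $ 1 + z $ 2 + z $ 3 = 1"
    using simplex_3D(2)[OF assms(1), of 1] by simp
  have "27 * coord_prod z \<noteq> 1" "27 * coord_prod z \<le> 1"
    using amgm_3[of "z $ 1" "z $ 2" "z $ 3"] simplex_3D(1)[OF assms(1)] assms(2) S
    by (auto simp: P)
  then show ?thesis by linarith
qed

text \<open>On the side where coordinate \<open>i + 2\<close> vanishes, the quantity \<open>p x\<^sub>i\<close> grows by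
  \<open>p\<^sup>2 x\<^sub>i x\<^sub>i\<^sub>+\<^sub>1\<close> in each step, whatever the sign of \<open>p\<close>.  So it cannot attain a maximum on the
  points of an invariant set that lie strictly inside this side.\<close>

lemma finite_invariant_no_edge_point:
  assumes "\<bar>p\<bar> \<le> 1" and "p \<noteq> 0" and "finite A" and "A \<subseteq> unit_simplex"
    and inv: "\<And>z. z \<in> A \<Longrightarrow> rps p z \<in> A"
    and "z \<in> A" and "z $ (i + 2) = 0"
  shows "z $ i = 0 \<or> z $ (i + 1) = 0"
proof (rule ccontr)
  define E where "E = {z \<in> A. z $ (i + 2) = 0 \<and> 0 < z $ i \<and> 0 < z $ (i + 1)}"
  assume "\<not> (z $ i = 0 \<or> z $ (i + 1) = 0)"
  moreover have "z \<in> unit_simplex"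
    using assms(4,6) by blast
  ultimately have "z \<in> E"
    using assms(6,7) simplex_3D(1)[of z i] simplex_3D(1)[of z "i + 1"] unfolding E_def by simp
  define h where "h w = p * w $ i" for w :: "real^3"
  have hE: "finite (h ` E)" "h ` E \<noteq> {}"
    using assms(3) \<open>z \<in> E\<close> by (auto simp: E_def)
  obtain y where y: "y \<in> E" "Max (h ` E) = h y"
    using Max_in[OF hE] by (rule imageE)
  have max: "h w \<le> h y" if "w \<in> E" for w
    using Max_ge[OF hE(1) imageI[OF that]] y(2) by simp
  have yA: "y \<in> A" "y $ (i + 2) = 0" "0 < y $ i" "0 < y $ (i + 1)"
    using y(1) unfolding E_def by simp_all
  have yS: "y \<in> unit_simplex"
    using yA(1) assms(4) by blast
  have "rps p y $ (i + 2) = 0"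
    using yA(2) by (simp add: rps_nth)
  then have "rps p y \<in> E"
    unfolding E_def using inv[OF yA(1)] rps_pos[OF assms(1) yS yA(3)] rps_pos[OF assms(1) yS yA(4)]
    by simp
  moreover have "h (rps p y) = h y + p\<^sup>2 * (y $ i * y $ (i + 1))"
    using yA(2) by (simp add: h_def rps_nth power2_eq_square algebra_simps)
  moreover have "0 < p\<^sup>2 * (y $ i * y $ (i + 1))"
    using yA assms(2) by simp
  ultimately show False
    using max[of "rps p y"] by linarith
qed

lemma bounded_no_geometric_growth:
  fixes f :: "nat \<Rightarrow> real"
  assumes "0 < q" and "0 < f N" and "\<And>n. N \<le> n \<Longrightarrow> f n * (1 + q) \<le> f (Suc n)"
    and "\<And>n. f n \<le> B"
  shows False
proof -
  have grow: "f N * (1 + q) ^ k \<le> f (N + k)" for k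
  proof (induction k)
    case (Suc k)
    have "f N * (1 + q) ^ Suc k \<le> f (N + k) * (1 + q)"
      using mult_right_mono[OF Suc, of "1 + q"] assms(1) by (simp add: ac_simps)
    also have "\<dots> \<le> f (N + Suc k)"
      using assms(3)[of "N + k"] by simp
    finally show ?case .
  qed simp
  obtain k where "B / f N < (1 + q) ^ k"
    using real_arch_pow[of "1 + q" "B / f N"] assms(1) by auto
  then have "B < f N * (1 + q) ^ k"
    using assms(2) by (simp add: field_simps)
  then show False
    using grow[of k] assms(4)[of "N + k"] by linarith
qed

text \<open>Near the vertex \<open>i\<close> the species that beats \<open>i\<close> multiplies by at least \<open>1 + \<bar>p\<bar> / 4\<close> in each
  step.  It is \<open>i + 2\<close> for positive and \<open>i + 1\<close> for negative \<open>p\<close>.\<close>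

lemma rps_leaves_vertex:
  assumes "\<bar>p\<bar> \<le> 1" and "p \<noteq> 0"
    and z: "\<And>n. z n \<in> unit_simplex" "\<And>n. z (Suc n) = rps p (z n)" "\<And>n j. 0 < z n $ j"
    and near: "\<And>n. N \<le> n \<Longrightarrow> z n $ (i + 1) < 1/4 \<and> z n $ (i + 2) < 1/4"
  shows False
proof -
  have big: "1/2 < z n $ i" if "N \<le> n" for n
    using near[OF that] simplex_3D(2)[OF z(1), of n i] by auto
  have le1: "z n $ j \<le> 1" for n j
    using simplex_3D[OF z(1)[of n]] by (smt (verit))
  show False
  proof (cases "0 < p")
    case True
    show False
    proof (rule bounded_no_geometric_growth[of "p / 4" "\<lambda>n. z n $ (i + 2)" N 1])
      fix n assume n: "N \<le> n"
      have "p * (1/4) \<le> p * (z n $ i - z n $ (i + 1))"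
        using near[OF n] big[OF n] True by (intro mult_left_mono) auto
      then show "z n $ (i + 2) * (1 + p / 4) \<le> z (Suc n) $ (i + 2)"
        using z(3)[of n "i + 2"] by (simp add: z(2) rps_nth add_index_3)
    qed (use True z(3) le1 in auto)
  next
    case False
    show False
    proof (rule bounded_no_geometric_growth[of "- p / 4" "\<lambda>n. z n $ (i + 1)" N 1])
      fix n assume n: "N \<le> n"
      have "(- p) * (1/4) \<le> (- p) * (z n $ i - z n $ (i + 2))"
        using near[OF n] big[OF n] False by (intro mult_left_mono) auto
      then have "- p / 4 \<le> p * (z n $ (i + 2) - z n $ i)"
        by (simp add: algebra_simps)
      then show "z n $ (i + 1) * (1 + - p / 4) \<le> z (Suc n) $ (i + 1)"
        using z(3)[of n "i + 1"] by (simp add: z(2) rps_nth add_index_3)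
    qed (use False assms(2) z(3) le1 in auto)
  qed
qed

lemma infinite_limit_points_rps:
  assumes p: "\<bar>p\<bar> \<le> 1" "p \<noteq> 0" and z0: "z0 \<in> unit_simplex" "\<And>i. 0 < z0 $ i"
    and off: "z0 $ 1 \<noteq> z0 $ 2 \<or> z0 $ 2 \<noteq> z0 $ 3"
  shows "infinite (limit_points (\<lambda>n. (rps p ^^ n) z0))" (is "infinite ?L")
proof
  assume fin: "finite ?L"
  define z where "z n = (rps p ^^ n) z0" for n
  have zS: "z n \<in> unit_simplex" for n
    by (induction n) (simp_all add: z_def z0 rps_in_simplex p)
  have zpos: "0 < z n $ j" for n j
    by (induction n) (use zS p rps_pos in \<open>auto simp: z_def z0\<close>)
  have zSuc: "z (Suc n) = rps p (z n)" for n
    by (simp add: z_def)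
  have LS: "?L \<subseteq> unit_simplex"
    using limit_points_subset_closed[OF compact_imp_closed[OF compact_unit_simplex] zS]
    by (simp add: z_def)
  have inv: "rps p l \<in> ?L" if "l \<in> ?L" for l
    using limit_points_orbit_invariant[OF that continuous_on_rps] .
  have dec: "decseq (\<lambda>n. coord_prod (z n))"
    by (intro decseq_SucI) (simp add: zSuc coord_prod_rps(1) p zS)
  have "0 \<le> coord_prod (z n)" for n
    using zpos by (simp add: coord_prod_def prod_nonneg less_imp_le)
  then obtain c where c: "(\<lambda>n. coord_prod (z n)) \<longlonglongrightarrow> c" "\<And>n. c \<le> coord_prod (z n)"
    using decseq_convergent[OF dec, of 0] by blast
  have const: "coord_prod l = c" if "l \<in> ?L" for l
    using limit_points_convergent[OF c(1)]
      limit_points_continuous_image[OF that continuous_on_coord_prod]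
    by (simp add: z_def)
  \<comment> \<open>A limit point and its image have the same product, so it is \<open>0\<close> or the value at the centre;
    the latter is excluded since the products decrease from below \<open>1/27\<close>.\<close>
  have "c < 1 / 27"
    using c(2)[of 0] coord_prod_max[OF z0(1) off] by (simp add: z_def)
  then have bd: "coord_prod l = 0" if "l \<in> ?L" for l
    using coord_prod_rps(2)[OF p, of l] const[OF that] const[OF inv[OF that]] LS that by auto
  have vertex: "l $ i = 0 \<or> l $ i = 1" if l: "l \<in> ?L" for l i
  proof -
    obtain k where "l $ k = 0"
      using bd[OF l] by (auto simp: coord_prod_def)
    then obtain j where j: "l $ (j + 2) = 0"
      using add_index_3(2)[of k] by metis
    have "l $ j = 0 \<or> l $ (j + 1) = 0"
      using finite_invariant_no_edge_point[OF p fin LS inv l j] .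
    moreover have "l $ j + l $ (j + 1) + l $ (j + 2) = 1"
      using simplex_3D(2) LS l by blast
    ultimately have "\<forall>i. l $ i = 0 \<or> l $ i = 1"
      using j forall_index_3[of "\<lambda>i. l $ i = 0 \<or> l $ i = 1" j] by auto
    then show ?thesis by blast
  qed
  \<comment> \<open>All limit points are vertices, so the trajectory is eventually close to the vertices.\<close>
  have "\<forall>\<^sub>F n in sequentially. z n $ i < 1/4 \<or> 3/4 < z n $ i" for i
  proof (rule ccontr)
    define C :: "(real^3) set" where "C = unit_simplex \<inter> {w. 1/4 \<le> w $ i \<and> w $ i \<le> 3/4}"
    assume "\<not> ?thesis"
    then have "\<exists>\<^sub>F n in sequentially. z n \<in> C"
      using zS by (simp add: not_eventually C_def not_less)
    moreover have "compact C"
      unfolding C_def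
      by (intro compact_Int_closed compact_unit_simplex closed_Collect_conj closed_Collect_le
          continuous_intros)
    ultimately obtain l where "l \<in> C" "l \<in> ?L"
      using limit_point_if_frequently by (metis (no_types, lifting) z_def ext)
    then show False
      using vertex[of l i] by (auto simp: C_def)
  qed
  then have "\<forall>\<^sub>F n in sequentially. \<forall>i. z n $ i < 1/4 \<or> 3/4 < z n $ i"
    by (simp add: eventually_all_finite)
  then obtain N where N: "\<And>n i. N \<le> n \<Longrightarrow> z n $ i < 1/4 \<or> 3/4 < z n $ i"
    by (auto simp: eventually_sequentially)
  \<comment> \<open>A coordinate at most doubles in one step, so it cannot jump over the gap from \<open>1/4\<close> to
    \<open>3/4\<close>.\<close>
  have small: "z n $ i < 1/4" if "z N $ i < 1/4" "N \<le> n" for n i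
    using that(2)
  proof (induction n rule: dec_induct)
    case (step n)
    have "p * (z n $ (i + 1) - z n $ (i + 2)) \<le> 1"
      using rps_factor_bound[OF p(1) zS, of n i] zpos[of n i] by linarith
    then have "z (Suc n) $ i \<le> z n $ i * 2"
      using zpos[of n i] unfolding zSuc rps_nth by (intro mult_left_mono) auto
    then show ?case
      using step N[of "Suc n" i] by auto
  qed (use that in auto)
  obtain i where i: "3/4 < z N $ i"
  proof -
    have "3/4 < z N $ 1 \<or> 3/4 < z N $ (1 + 1) \<or> 3/4 < z N $ (1 + 2)"
      using N[OF order_refl, of 1] N[OF order_refl, of "1 + 1"] N[OF order_refl, of "1 + 2"]
        simplex_3D(2)[OF zS, of N 1] by argo
    then show thesis
      using that by blast
  qed
  then have "z N $ (i + 1) < 1/4" "z N $ (i + 2) < 1/4"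
    using simplex_3D(2)[OF zS, of N i] zpos[of N "i + 1"] zpos[of N "i + 2"] by linarith+
  then show False
    using rps_leaves_vertex[of p z N i] p zS zSuc zpos small by blast
qed

section \<open>The operator in a rotating frame\<close>

definition lotka :: "real \<Rightarrow> real^5 \<Rightarrow> real^5" where
  "lotka p x = vector
     [x $ 1 * (1 + p * (x $ 2 - x $ 3 + x $ 4 - x $ 5)),
      x $ 2 * (1 - p * (x $ 1 - x $ 3 + x $ 4 - x $ 5)),
      x $ 3 * (1 + p * (x $ 1 - x $ 2 + x $ 4 - x $ 5)),
      x $ 4 * (1 - p * (x $ 1 - x $ 2 + x $ 3 - x $ 5)),
      x $ 5 * (1 + p * (x $ 1 - x $ 2 + x $ 3 - x $ 4))]"

lemma W_eq_T_pi_lotka: "W p x = T_pi (lotka p x)"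
  by (simp add: vec_eq_iff forall_5 W_def T_pi_def lotka_def)

text \<open>The tournament behind \<open>lotka\<close> is invariant under the cyclic shift: each species beats the
  first and the third one after it and loses to the other two.\<close>

lemma lotka_T_pi: "lotka p (T_pi x) = T_pi (lotka p x)"
  by (simp add: vec_eq_iff forall_5 T_pi_def lotka_def algebra_simps)

lemma lotka_T_pi_funpow: "lotka p ((T_pi ^^ n) x) = (T_pi ^^ n) (lotka p x)"
  by (induction n) (simp_all add: lotka_T_pi)

lemma W_funpow: "(W p ^^ n) x = (T_pi ^^ n) ((lotka p ^^ n) x)"
  by (induction n) (simp_all add: W_eq_T_pi_lotka lotka_T_pi_funpow)

lemma T_pi_funpow_5: "(T_pi ^^ 5) x = x"
  by (simp add: vec_eq_iff forall_5 T_pi_def eval_nat_numeral)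

lemma T_pi_funpow_mod: "T_pi ^^ n = T_pi ^^ (n mod 5)"
proof -
  have "T_pi ^^ 5 = id"
    by (simp add: fun_eq_iff T_pi_funpow_5)
  then have "T_pi ^^ (5 * (n div 5)) = id"
    by (simp flip: funpow_mult)
  then show ?thesis
    by (metis comp_id funpow_add mod_mult_div_eq)
qed

lemma norm_T_pi_diff: "norm (T_pi x - T_pi y) = norm (x - y)"
  by (simp add: norm_vec_def L2_set_def sum_5 T_pi_def ac_simps)

lemma norm_T_pi_funpow_diff: "norm ((T_pi ^^ n) x - (T_pi ^^ n) y) = norm (x - y)"
  by (induction n) (simp_all add: norm_T_pi_diff)

lemma inj_T_pi_funpow: "inj (T_pi ^^ n)"
  by (metis injI norm_T_pi_funpow_diff norm_eq_zero right_minus_eq)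

lemma continuous_on_T_pi_funpow: "continuous_on UNIV (T_pi ^^ n)"
  by (auto simp: continuous_on_iff dist_norm norm_T_pi_funpow_diff)

lemma lotka_in_S4:
  assumes "\<bar>p\<bar> \<le> 1" and "x \<in> S4"
  shows "lotka p x \<in> S4"
proof -
  have "T_pi (lotka p x) \<in> S4"
    using W_in_S4[of p x] assms by (simp add: W_eq_T_pi_lotka abs_le_iff)
  then show ?thesis
    by (simp add: S4_def forall_5 sum_5 T_pi_def ac_simps)
qed

text \<open>On the face \<open>x\<^sub>5 = 0\<close> species 1 and 4 have the same payoff against species 2 and 3, so only
  their total matters to the others.\<close>

definition merge_1_4 :: "real^5 \<Rightarrow> real^3" where
  "merge_1_4 x = vector [x $ 1 + x $ 4, x $ 2, x $ 3]"

lemma continuous_on_merge_1_4: "continuous_on UNIV merge_1_4"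
proof -
  have "continuous_on UNIV (\<lambda>x. merge_1_4 x $ i)" for i
    using exhaust_3[of i]
    by (elim disjE) (simp_all add: merge_1_4_def continuous_on_add continuous_on_component)
  then show ?thesis
    using continuous_on_vec_lambda[of UNIV "\<lambda>i x. merge_1_4 x $ i"] by (simp add: vec_nth_inverse)
qed

lemma merge_1_4_lotka:
  assumes "x $ 5 = 0"
  shows "merge_1_4 (lotka p x) = rps p (merge_1_4 x)" and "lotka p x $ 5 = 0"
  using assms by (simp_all add: vec_eq_iff forall_3 merge_1_4_def lotka_def rps_nth
      reduce_index_3 algebra_simps)

lemma merge_1_4_lotka_funpow:
  assumes "x $ 5 = 0"
  shows "merge_1_4 ((lotka p ^^ n) x) = (rps p ^^ n) (merge_1_4 x)" and "(lotka p ^^ n) x $ 5 = 0"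
proof -
  have "merge_1_4 ((lotka p ^^ n) x) = (rps p ^^ n) (merge_1_4 x) \<and> (lotka p ^^ n) x $ 5 = 0"
    by (induction n) (simp_all add: assms merge_1_4_lotka)
  then show "merge_1_4 ((lotka p ^^ n) x) = (rps p ^^ n) (merge_1_4 x)" "(lotka p ^^ n) x $ 5 = 0"
    by blast+
qed

section \<open>The segment and the periodic orbit\<close>

text \<open>The parametrisation behind \<open>seg_MN\<close>: its values at \<open>0\<close> and \<open>1\<close> are the first two points of
  \<open>orbit5\<close>.\<close>

definition seg_point :: "real \<Rightarrow> real^5" where
  "seg_point u = vector [(1 - u) / 3, 1/3, 1/3, u / 3, 0]"

lemma lotka_seg_point: "lotka p (seg_point u) = seg_point (u * (1 - p / 3 * (1 - u)))"
  by (simp add: vec_eq_iff forall_5 seg_point_def lotka_def field_simps)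

lemma lotka_funpow_seg_point:
  "(lotka p ^^ n) (seg_point u) = seg_point (((\<lambda>u. u * (1 - p / 3 * (1 - u))) ^^ n) u)"
  by (induction n) (simp_all add: lotka_seg_point)

text \<open>The sequence stays in the open unit interval and is monotone there, and the only fixed points
  of the recursion are \<open>0\<close> and \<open>1\<close>.\<close>

lemma logistic_tendsto:
  fixes q :: real and u :: "nat \<Rightarrow> real"
  assumes q: "\<bar>q\<bar> \<le> 1" "q \<noteq> 0" and u0: "0 < u 0" "u 0 < 1"
    and rec: "\<And>n. u (Suc n) = u n * (1 - q * (1 - u n))"
  shows "u \<longlonglongrightarrow> (if 0 < q then 0 else 1)"
proof -
  have I: "0 < u n \<and> u n < 1" for n
  proof (induction n)
    case (Suc n)
    have "\<bar>q * (1 - u n)\<bar> \<le> 1 - u n" "\<bar>q * u n\<bar> \<le> u n"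
      using Suc q(1) by (simp_all add: abs_mult mult_left_le_one_le)
    then have "0 < 1 - q * (1 - u n)" "0 < 1 + q * u n"
      using Suc abs_le_D1[of "q * (1 - u n)"] abs_le_D2[of "q * u n"] by linarith+
    then have "0 < u n * (1 - q * (1 - u n))" "0 < (1 - u n) * (1 + q * u n)"
      using Suc by simp_all
    then show ?case
      by (simp add: rec algebra_simps)
  qed (use u0 in auto)
  have step: "u (Suc n) - u n = - q * (u n * (1 - u n))" for n
    by (simp add: rec algebra_simps)
  have pos: "0 < u n * (1 - u n)" for n
    using I[of n] by simp
  have fixpt: "L = 0 \<or> L = 1" if L: "u \<longlonglongrightarrow> L" for L
  proof -
    have "(\<lambda>n. u (Suc n)) \<longlonglongrightarrow> L * (1 - q * (1 - L))"
      unfolding rec using L by (intro tendsto_intros)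
    then have "L = L * (1 - q * (1 - L))"
      using LIMSEQ_Suc[OF L] LIMSEQ_unique by blast
    then have "q * (L * (1 - L)) = 0"
      by (simp add: algebra_simps)
    then show ?thesis
      using q(2) by simp
  qed
  show ?thesis
  proof (cases "0 < q")
    case True
    have "decseq u"
      using step pos True by (intro decseq_SucI) (smt (verit) mult_pos_pos mult_minus_left)
    then obtain L where L: "u \<longlonglongrightarrow> L" "\<And>n. L \<le> u n"
      using decseq_convergent[of u 0] I by (metis less_imp_le)
    then show ?thesis
      using fixpt[OF L(1)] L(2)[of 0] u0 True by auto
  next
    case False
    then have "q < 0" using q(2) by simp
    have "incseq u"
      using step mult_neg_pos[OF \<open>q < 0\<close> pos] by (intro incseq_SucI) (smt (verit) mult_minus_left)
    then obtain L where L: "u \<longlonglongrightarrow> L" "\<And>n. u n \<le> L"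
      using incseq_convergent[of u 1] I by (metis less_imp_le)
    then show ?thesis
      using fixpt[OF L(1)] L(2)[of 0] u0 False by auto
  qed
qed

text \<open>In the frame moving with the shift, both end points of the segment are fixed and the
  trajectory tends to one of them.  Positive \<open>p\<close> selects \<open>M\<close>, negative \<open>p\<close> selects \<open>N\<close>.\<close>

lemma seg_converges_to_orbit:
  assumes p: "\<bar>p\<bar> \<le> 1" "p \<noteq> 0" and u: "0 < u" "u < 1"
  shows "trajectory_converges_to_orbit (W p) (seg_point u) (set orbit5)"
proof -
  define v where "v n = ((\<lambda>u. u * (1 - p / 3 * (1 - u))) ^^ n) u" for n
  define e :: real where "e = (if 0 < p then 0 else 1)"
  have "v \<longlonglongrightarrow> e"
    using logistic_tendsto[of "p / 3" v] p u by (simp add: v_def e_def)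
  then have "(\<lambda>n. \<bar>v n - e\<bar> * norm (seg_point 1 - seg_point 0)) \<longlonglongrightarrow> 0"
    by (intro tendsto_mult_left_zero tendsto_rabs_zero) (simp add: LIM_zero_iff)
  moreover have seg_diff: "seg_point a - seg_point b = (a - b) *\<^sub>R (seg_point 1 - seg_point 0)" for a b
    by (simp add: vec_eq_iff forall_5 seg_point_def field_simps)
  have "norm ((W p ^^ n) (seg_point u) - (W p ^^ n) (seg_point e)) =
      \<bar>v n - e\<bar> * norm (seg_point 1 - seg_point 0)" for n
  proof -
    have "(lotka p ^^ n) (seg_point e) = seg_point e"
      by (induction n) (simp_all add: lotka_seg_point e_def)
    then show ?thesis
      unfolding W_funpow norm_T_pi_funpow_diff lotka_funpow_seg_point[of _ _ u] v_def[symmetric]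
      by (metis seg_diff norm_scaleR)
  qed
  moreover have "seg_point e \<in> set orbit5"
    by (simp add: orbit5_def seg_point_def e_def)
  ultimately show ?thesis
    unfolding trajectory_converges_to_orbit_def by (intro bexI[of _ "seg_point e"]) simp
qed

lemma periodic_orbit_orbit5: "periodic_orbit (W p) 5 orbit5"
proof -
  have "W p (orbit5 ! i) = orbit5 ! ((i + 1) mod 5)" if "i < 5" for i
  proof -
    have "i = 0 \<or> i = 1 \<or> i = 2 \<or> i = 3 \<or> i = 4"
      using that by linarith
    then show ?thesis
      by (elim disjE) (simp_all add: orbit5_def W_def vec_eq_iff forall_5)
  qed
  then show ?thesis
    by (simp add: periodic_orbit_def) (simp add: orbit5_def vec_eq_iff forall_5)
qed

text \<open>Every point of \<open>seg_MN\<close> has fifth coordinate zero, and a proper shift moves this zero into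
  one of the first four places.\<close>

lemma seg_of_pi_orbit:
  assumes "x \<in> pi_orbit seg_MN" and "x $ 1 \<noteq> 0" "x $ 2 \<noteq> 0" "x $ 3 \<noteq> 0" "x $ 4 \<noteq> 0"
  shows "x \<in> seg_MN"
  using assms by (auto simp: pi_orbit_def seg_MN_def T_pi_def eval_nat_numeral)

theorem theorem4:
  fixes p :: real and x0 :: "real^5"
  assumes "p \<in> {-1..1}" and "p \<noteq> 0"
    and "x0 \<in> S4" and "x0 $ 5 = 0"
    and "x0 $ 1 \<noteq> 0" and "x0 $ 2 \<noteq> 0" and "x0 $ 3 \<noteq> 0" and "x0 $ 4 \<noteq> 0"
  shows "periodic_orbit (W p) 5 orbit5 \<and>
    (x0 \<in> pi_orbit seg_MN \<longrightarrow>
       trajectory_converges_to_orbit (W p) x0 (set orbit5)) \<and>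
    (x0 \<notin> pi_orbit seg_MN \<longrightarrow>
       \<not> convergent (\<lambda>n. (W p ^^ n) x0) \<and>
       infinite (limit_points (\<lambda>n. (W p ^^ n) x0)) \<and>
       limit_points (\<lambda>n. (W p ^^ n) x0) \<subseteq> boundary_S4)"
proof (intro conjI impI)
  have p: "\<bar>p\<bar> \<le> 1" "p \<noteq> 0"
    using assms(1,2) by auto
  show "periodic_orbit (W p) 5 orbit5"
    by (rule periodic_orbit_orbit5)
  show "trajectory_converges_to_orbit (W p) x0 (set orbit5)" if x0: "x0 \<in> pi_orbit seg_MN"
  proof -
    obtain u where u: "x0 = seg_point u" "0 \<le> u" "u \<le> 1"
      using seg_of_pi_orbit[OF x0 assms(5-8)] by (auto simp: seg_MN_def seg_point_def)
    then have "u \<noteq> 0" "u \<noteq> 1"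
      using assms(5,8) by (auto simp: seg_point_def)
    then show ?thesis
      using seg_converges_to_orbit[OF p, of u] u by simp
  qed
  have WS: "(W p ^^ n) x0 \<in> S4" for n
    by (induction n) (use assms W_in_S4 in auto)
  have WB: "(W p ^^ n) x0 \<in> boundary_S4" for n
  proof -
    have "x $ 1 * x $ 2 * x $ 3 * x $ 4 * x $ 5 = 0 \<Longrightarrow>
        W p x $ 1 * W p x $ 2 * W p x $ 3 * W p x $ 4 * W p x $ 5 = 0" for x
      by (auto simp: W_def)
    then have "(W p ^^ n) x0 $ 1 * (W p ^^ n) x0 $ 2 * (W p ^^ n) x0 $ 3 * (W p ^^ n) x0 $ 4
        * (W p ^^ n) x0 $ 5 = 0"
      by (induction n) (simp_all add: assms(4))
    then show ?thesis
      using WS by (simp add: boundary_S4_def)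
  qed
  have S4: "S4 = unit_simplex"
    by (simp add: S4_def unit_simplex_def)
  have "closed (S4 \<inter> {x. x $ 1 * x $ 2 * x $ 3 * x $ 4 * x $ 5 = (0::real)})"
    unfolding S4
    by (intro closed_Int compact_imp_closed[OF compact_unit_simplex] closed_Collect_eq
        continuous_intros)
  then have "closed boundary_S4"
    by (simp add: boundary_S4_def Collect_conj_eq)
  then show "limit_points (\<lambda>n. (W p ^^ n) x0) \<subseteq> boundary_S4"
    using WB by (rule limit_points_subset_closed)
  show inf: "infinite (limit_points (\<lambda>n. (W p ^^ n) x0))" if x0: "x0 \<notin> pi_orbit seg_MN"
  proof -
    have nn: "\<And>i. 0 \<le> x0 $ i" and s: "x0 $ 1 + x0 $ 2 + x0 $ 3 + x0 $ 4 = 1"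
      using assms(3,4) by (auto simp: S4_def sum_5)
    have "x0 \<notin> seg_MN"
      using x0 by (simp add: pi_orbit_def)
    then have off: "merge_1_4 x0 $ 1 \<noteq> merge_1_4 x0 $ 2 \<or> merge_1_4 x0 $ 2 \<noteq> merge_1_4 x0 $ 3"
    proof (rule contrapos_np)
      assume "\<not> ?thesis"
      then have eq: "x0 $ 2 = 1/3" "x0 $ 3 = 1/3" "x0 $ 1 + x0 $ 4 = 1/3"
        using s by (auto simp: merge_1_4_def)
      then have "x0 = vector [(1 - 3 * x0 $ 4) / 3, 1/3, 1/3, (3 * x0 $ 4) / 3, 0]"
        using assms(4) by (auto simp: vec_eq_iff forall_5)
      moreover have "3 * x0 $ 4 \<in> {0..1}"
        using eq nn[of 1] nn[of 4] by auto
      ultimately show "x0 \<in> seg_MN"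
        unfolding seg_MN_def by blast
    qed
    have pos: "0 < x0 $ 1" "0 < x0 $ 2" "0 < x0 $ 3" "0 < x0 $ 4"
      using nn assms(5-8) by (simp_all add: less_le)
    then have mpos: "0 < merge_1_4 x0 $ i" for i
      using exhaust_3[of i] by (elim disjE) (simp_all add: merge_1_4_def)
    have "merge_1_4 x0 \<in> unit_simplex"
      using mpos s by (auto simp: unit_simplex_def sum_3 merge_1_4_def less_imp_le)
    then have "infinite (limit_points (\<lambda>n. (rps p ^^ n) (merge_1_4 x0)))"
      using infinite_limit_points_rps[OF p _ mpos off] by blast
    then have "infinite (limit_points (\<lambda>n. merge_1_4 ((lotka p ^^ n) x0)))"
      by (simp add: merge_1_4_lotka_funpow(1)[OF assms(4)])
    moreover have "(lotka p ^^ n) x0 \<in> S4" for n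
      by (induction n) (simp_all add: assms(3) lotka_in_S4 p)
    ultimately have "infinite (limit_points (\<lambda>n. (lotka p ^^ n) x0))"
      using limit_points_image_compact[OF compact_unit_simplex _ continuous_on_merge_1_4]
      unfolding S4 by (meson finite_imageI finite_subset)
    moreover have "(W p ^^ n) x0 = (T_pi ^^ (n mod 5)) ((lotka p ^^ n) x0)" for n
      using T_pi_funpow_mod[of n] by (simp add: W_funpow)
    ultimately show ?thesis
      using infinite_limit_points_moving_frame[where k = 5 and h = "\<lambda>i. T_pi ^^ i",
          OF _ inj_T_pi_funpow continuous_on_T_pi_funpow]
      by simp
  qed
  show "\<not> convergent (\<lambda>n. (W p ^^ n) x0)" if x0: "x0 \<notin> pi_orbit seg_MN"
  proof
    assume "convergent (\<lambda>n. (W p ^^ n) x0)"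
    then obtain L where "limit_points (\<lambda>n. (W p ^^ n) x0) \<subseteq> {L}"
      unfolding convergent_def using limit_points_convergent by blast
    then show False
      using inf[OF x0] finite_subset by blast
  qed
qed

end
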